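(* Let $(M,\circ,e,\mathcal{E},\tilde{\mathcal{S}})$ be an $F$-manifold with an eventual identity $\mathcal{E}$ and a special family of connections $\tilde{\mathcal{S}}$. Choose any $\tilde{\nabla}\in\tilde{\mathcal{S}}$ and define the family of connections $$\mathcal{D}_{\mathcal{E}}(\tilde{\mathcal{S}})=\mathcal{S}:=\{\nabla^{W},\ W\in\mathcal{X}(M)\},$$ where $$\nabla^{W}_{X}(Y)=\mathcal{E}\circ\tilde{\nabla}_{X}(\mathcal{E}^{-1}\circ Y)-\tilde{\nabla}_{\mathcal{E}^{-1}\circ Y}(\mathcal{E})\circ X+W*X*Y,\qquad\forall X,Y\in\mathcal{X}(M),$$ and $*$ is the dual multiplication $X*Y=X\circ Y\circ\mathcal{E}^{-1}$. Then $\mathcal{S}$ is special on the dual $F$-manifold $(M,*,\mathcal{E})$ and the map $$(M,\circ,e,\mathcal{E},\tilde{\mathcal{S}})\rightarrow(M,*,\mathcal{E},e,\mathcal{S})$$ is an involution on the set of $F$-manifolds with eventual identities and special families of connections.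
   Context: Everything is in the smooth category; $\mathcal{X}(M)$ denotes the vector fields on the manifold $M$. $F$-manifold: a triple $(M,\circ,e)$ where $M$ is a manifold and $\circ$ is a fiber-preserving commutative, associative, bilinear multiplication on $TM$ with unit field $e$, such that $L_{X\circ Y}(\circ)=X\circ L_{Y}(\circ)+Y\circ L_{X}(\circ)$ for all $X,Y\in\mathcal{X}(M)$, where $L_{Z}(\circ)(X,Y)=[Z,X\circ Y]-[Z,X]\circ Y-X\circ[Z,Y]$. Invertible vector field: $\mathcal{E}$ is invertible if there is a vector field $\mathcal{E}^{-1}$ with $\mathcal{E}\circ\mathcal{E}^{-1}=e$. Eventual identity on an $F$-manifold $(M,\circ,e)$: an invertible vector field $\mathcal{E}$ such that the multiplication $X*Y:=X\circ Y\circ\mathcal{E}^{-1}$ (whose unit field is $\mathcal{E}$) defines an $F$-manifold $(M,*,\mathcal{E})$, called the dual $F$-manifold. It is known that then $e$ is an eventual identity on $(M,*,\mathcal{E})$ and that $(M,\circ,e,\mathcal{E})\mapsto(M,*,\mathcal{E},e)$ is an involution on the set of $F$-manifolds with eventual identities. Compatible connection: a connection $\nabla$ on $TM$ is compatible with a commutative, associative multiplication $\circ$ on $TM$ if $\nabla_{X}(\circ)(Y,Z):=\nabla_{X}(Y\circ Z)-\nabla_{X}(Y)\circ Z-Y\circ\nabla_{X}(Z)$ is totally symmetric in $X,Y,Z$. Special family: a family of connections $\tilde{\mathcal{S}}$ on an $F$-manifold $(M,\circ,e)$ is special if $\tilde{\mathcal{S}}=\{\tilde{\nabla}^{V},\ V\in\mathcal{X}(M)\}$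 where $\tilde{\nabla}^{V}_{X}(Y):=\tilde{\nabla}_{X}(Y)+V\circ X\circ Y$ and $\tilde{\nabla}$ is a torsion-free connection compatible with $\circ$. *)

theory Defs
  imports "HOL-Analysis.Analysis" "HOL-Library.Function_Algebras"
begin

text \<open>
  Functions carry the pointwise \<open>0\<close>, \<open>+\<close>, \<open>-\<close> (and \<open>*\<close> on scalar functions) of
  \<open>Function_Algebras\<close>. Scalar functions on \<open>M\<close>, tangent vectors, vector fields and fibre
  multiplications are represented by total functions that vanish outside their proper domain, and
  connections by extensional functions, so that HOL equality is equality of the geometric objects.
\<close>

fun C_k_on :: "nat \<Rightarrow> 'e::real_normed_vector set \<Rightarrow> ('e \<Rightarrow> 'f::real_normed_vector) \<Rightarrow> bool" where
  "C_k_on 0 S f \<longleftrightarrow> continuous_on S f"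
| "C_k_on (Suc k) S f \<longleftrightarrow>
     (\<forall>x\<in>S. f differentiable (at x)) \<and> (\<forall>v. C_k_on k S (\<lambda>x. frechet_derivative f (at x) v))"

text \<open>Only used for open \<open>S\<close>.\<close>

definition smooth_on :: "'e::real_normed_vector set \<Rightarrow> ('e \<Rightarrow> 'f::real_normed_vector) \<Rightarrow> bool" where
  "smooth_on S f \<longleftrightarrow> (\<forall>k. C_k_on k S f)"

record ('a, 'e) manifold =
  mtop :: "'a topology"
  atlas :: "('a set \<times> ('a \<Rightarrow> 'e)) set"

abbreviation points :: "('a, 'e) manifold \<Rightarrow> 'a set" where
  "points M \<equiv> topspace (mtop M)"

definition smooth_manifold :: "('a, 'e::euclidean_space) manifold \<Rightarrow> bool" where
  "smooth_manifold M \<longleftrightarrow>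
     Hausdorff_space (mtop M) \<and> second_countable (mtop M) \<and>
     (\<Union>(U, \<phi>)\<in>atlas M. U) = points M \<and>
     (\<forall>(U, \<phi>)\<in>atlas M. openin (mtop M) U \<and> open (\<phi> ` U) \<and>
        homeomorphic_map (subtopology (mtop M) U) (top_of_set (\<phi> ` U)) \<phi>) \<and>
     (\<forall>(U, \<phi>)\<in>atlas M. \<forall>(V, \<psi>)\<in>atlas M. smooth_on (\<phi> ` (U \<inter> V)) (\<psi> \<circ> inv_into U \<phi>))"

definition smooth_funs :: "('a, 'e::euclidean_space) manifold \<Rightarrow> ('a \<Rightarrow> real) set" where
  "smooth_funs M =
     {f. (\<forall>p. p \<notin> points M \<longrightarrow> f p = 0) \<and>
         (\<forall>(U, \<phi>)\<in>atlas M. smooth_on (\<phi> ` U) (f \<circ> inv_into U \<phi>))}"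

text \<open>Tangent vectors at \<open>p\<close> are the point derivations of the algebra of smooth functions.\<close>

type_synonym 'a tvec = "('a \<Rightarrow> real) \<Rightarrow> real"
type_synonym 'a vfield = "'a \<Rightarrow> 'a tvec"

definition tscale :: "real \<Rightarrow> 'a tvec \<Rightarrow> 'a tvec" where
  "tscale c v = (\<lambda>f. c * v f)"

definition tangent_space :: "('a, 'e::euclidean_space) manifold \<Rightarrow> 'a \<Rightarrow> 'a tvec set" where
  "tangent_space M p =
     {v. (\<forall>f. f \<notin> smooth_funs M \<longrightarrow> v f = 0) \<and>
         (\<forall>f\<in>smooth_funs M. \<forall>g\<in>smooth_funs M. v (f + g) = v f + v g) \<and>
         (\<forall>c. \<forall>f\<in>smooth_funs M. v (\<lambda>x. c * f x) = c * v f) \<and>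
         (\<forall>f\<in>smooth_funs M. \<forall>g\<in>smooth_funs M. v (f * g) = v f * g p + f p * v g)}"

definition vf_apply :: "'a vfield \<Rightarrow> ('a \<Rightarrow> real) \<Rightarrow> 'a \<Rightarrow> real" where
  "vf_apply X f = (\<lambda>p. X p f)"

definition vector_fields :: "('a, 'e::euclidean_space) manifold \<Rightarrow> 'a vfield set" where
  "vector_fields M =
     {X. (\<forall>p\<in>points M. X p \<in> tangent_space M p) \<and> (\<forall>p. p \<notin> points M \<longrightarrow> X p = 0) \<and>
         (\<forall>f\<in>smooth_funs M. vf_apply X f \<in> smooth_funs M)}"

definition vf_scale :: "('a \<Rightarrow> real) \<Rightarrow> 'a vfield \<Rightarrow> 'a vfield" where
  "vf_scale f X = (\<lambda>p. tscale (f p) (X p))"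

definition lie_bracket :: "'a vfield \<Rightarrow> 'a vfield \<Rightarrow> 'a vfield" where
  "lie_bracket X Y = (\<lambda>p f. X p (vf_apply Y f) - Y p (vf_apply X f))"

type_synonym 'a tmult = "'a \<Rightarrow> 'a tvec \<Rightarrow> 'a tvec \<Rightarrow> 'a tvec"

definition vf_mult :: "'a tmult \<Rightarrow> 'a vfield \<Rightarrow> 'a vfield \<Rightarrow> 'a vfield" where
  "vf_mult m X Y = (\<lambda>p. m p (X p) (Y p))"

text \<open>
  Bilinearity in the second argument follows from commutativity. The last clause is smoothness of
  the bundle map \<open>TM \<otimes> TM \<rightarrow> TM\<close>.
\<close>

definition tangent_mult :: "('a, 'e::euclidean_space) manifold \<Rightarrow> 'a tmult \<Rightarrow> bool" where
  "tangent_mult M m \<longleftrightarrow>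
     (\<forall>p v w. \<not> (p \<in> points M \<and> v \<in> tangent_space M p \<and> w \<in> tangent_space M p) \<longrightarrow> m p v w = 0) \<and>
     (\<forall>p\<in>points M. \<forall>u\<in>tangent_space M p. \<forall>v\<in>tangent_space M p. \<forall>w\<in>tangent_space M p.
        m p u v \<in> tangent_space M p \<and>
        m p u v = m p v u \<and>
        m p (m p u v) w = m p u (m p v w) \<and>
        m p (u + v) w = m p u w + m p v w \<and>
        (\<forall>c. m p (tscale c u) v = tscale c (m p u v))) \<and>
     (\<forall>X\<in>vector_fields M. \<forall>Y\<in>vector_fields M. vf_mult m X Y \<in> vector_fields M)"

definition unit_field :: "('a, 'e::euclidean_space) manifold \<Rightarrow> 'a tmult \<Rightarrow> 'a vfield \<Rightarrow> bool" where
  "unit_field M m e \<longleftrightarrow>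
     e \<in> vector_fields M \<and> (\<forall>p\<in>points M. \<forall>v\<in>tangent_space M p. m p (e p) v = v)"

definition lie_mult :: "'a tmult \<Rightarrow> 'a vfield \<Rightarrow> 'a vfield \<Rightarrow> 'a vfield \<Rightarrow> 'a vfield" where
  "lie_mult m Z X Y =
     lie_bracket Z (vf_mult m X Y) - vf_mult m (lie_bracket Z X) Y - vf_mult m X (lie_bracket Z Y)"

definition F_manifold :: "('a, 'e::euclidean_space) manifold \<Rightarrow> 'a tmult \<Rightarrow> 'a vfield \<Rightarrow> bool" where
  "F_manifold M m e \<longleftrightarrow>
     smooth_manifold M \<and> tangent_mult M m \<and> unit_field M m e \<and>
     (\<forall>X\<in>vector_fields M. \<forall>Y\<in>vector_fields M. \<forall>Z\<in>vector_fields M. \<forall>W\<in>vector_fields M.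
        lie_mult m (vf_mult m X Y) Z W =
        vf_mult m X (lie_mult m Y Z W) + vf_mult m Y (lie_mult m X Z W))"

definition invertible_field ::
    "('a, 'e::euclidean_space) manifold \<Rightarrow> 'a tmult \<Rightarrow> 'a vfield \<Rightarrow> 'a vfield \<Rightarrow> bool" where
  "invertible_field M m e E \<longleftrightarrow>
     E \<in> vector_fields M \<and> (\<exists>F\<in>vector_fields M. vf_mult m E F = e)"

definition inverse_field ::
    "('a, 'e::euclidean_space) manifold \<Rightarrow> 'a tmult \<Rightarrow> 'a vfield \<Rightarrow> 'a vfield \<Rightarrow> 'a vfield" where
  "inverse_field M m e E = (THE F. F \<in> vector_fields M \<and> vf_mult m E F = e)"

definition dual_mult ::
    "('a, 'e::euclidean_space) manifold \<Rightarrow> 'a tmult \<Rightarrow> 'a vfield \<Rightarrow> 'a vfield \<Rightarrow> 'a tmult" where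
  "dual_mult M m e E = (\<lambda>p v w. m p (m p v w) (inverse_field M m e E p))"

definition eventual_identity ::
    "('a, 'e::euclidean_space) manifold \<Rightarrow> 'a tmult \<Rightarrow> 'a vfield \<Rightarrow> 'a vfield \<Rightarrow> bool" where
  "eventual_identity M m e E \<longleftrightarrow>
     F_manifold M m e \<and> invertible_field M m e E \<and> F_manifold M (dual_mult M m e E) E"

type_synonym 'a conn = "'a vfield \<Rightarrow> 'a vfield \<Rightarrow> 'a vfield"

definition connection :: "('a, 'e::euclidean_space) manifold \<Rightarrow> 'a conn \<Rightarrow> bool" where
  "connection M D \<longleftrightarrow>
     D \<in> vector_fields M \<rightarrow>\<^sub>E vector_fields M \<rightarrow>\<^sub>E vector_fields M \<and>
     (\<forall>X\<in>vector_fields M. \<forall>Y\<in>vector_fields M. \<forall>Z\<in>vector_fields M.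
        D (X + Y) Z = D X Z + D Y Z \<and> D X (Y + Z) = D X Y + D X Z) \<and>
     (\<forall>f\<in>smooth_funs M. \<forall>X\<in>vector_fields M. \<forall>Y\<in>vector_fields M.
        D (vf_scale f X) Y = vf_scale f (D X Y) \<and>
        D X (vf_scale f Y) = vf_scale (vf_apply X f) Y + vf_scale f (D X Y))"

definition torsion_free :: "('a, 'e::euclidean_space) manifold \<Rightarrow> 'a conn \<Rightarrow> bool" where
  "torsion_free M D \<longleftrightarrow>
     (\<forall>X\<in>vector_fields M. \<forall>Y\<in>vector_fields M. D X Y - D Y X = lie_bracket X Y)"

definition cov_mult :: "'a tmult \<Rightarrow> 'a conn \<Rightarrow> 'a vfield \<Rightarrow> 'a vfield \<Rightarrow> 'a vfield \<Rightarrow> 'a vfield" where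
  "cov_mult m D X Y Z = D X (vf_mult m Y Z) - vf_mult m (D X Y) Z - vf_mult m Y (D X Z)"

text \<open>The two transpositions generate all permutations of the three arguments.\<close>

definition compatible :: "('a, 'e::euclidean_space) manifold \<Rightarrow> 'a tmult \<Rightarrow> 'a conn \<Rightarrow> bool" where
  "compatible M m D \<longleftrightarrow>
     (\<forall>X\<in>vector_fields M. \<forall>Y\<in>vector_fields M. \<forall>Z\<in>vector_fields M.
        cov_mult m D X Y Z = cov_mult m D Y X Z \<and> cov_mult m D X Y Z = cov_mult m D X Z Y)"

definition shifted_conn ::
    "('a, 'e::euclidean_space) manifold \<Rightarrow> 'a tmult \<Rightarrow> 'a conn \<Rightarrow> 'a vfield \<Rightarrow> 'a conn" where
  "shifted_conn M m D V =
     (\<lambda>X\<in>vector_fields M. \<lambda>Y\<in>vector_fields M. D X Y + vf_mult m (vf_mult m V X) Y)"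

definition special_family ::
    "('a, 'e::euclidean_space) manifold \<Rightarrow> 'a tmult \<Rightarrow> 'a vfield \<Rightarrow> 'a conn set \<Rightarrow> bool" where
  "special_family M m e S \<longleftrightarrow>
     F_manifold M m e \<and>
     (\<exists>D. connection M D \<and> torsion_free M D \<and> compatible M m D \<and>
          S = {shifted_conn M m D V | V. V \<in> vector_fields M})"

definition dual_conn ::
    "('a, 'e::euclidean_space) manifold \<Rightarrow> 'a tmult \<Rightarrow> 'a vfield \<Rightarrow> 'a vfield \<Rightarrow> 'a conn \<Rightarrow>
     'a vfield \<Rightarrow> 'a conn" where
  "dual_conn M m e E D W =
     (\<lambda>X\<in>vector_fields M. \<lambda>Y\<in>vector_fields M.
        vf_mult m E (D X (vf_mult m (inverse_field M m e E) Y))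
        - vf_mult m (D (vf_mult m (inverse_field M m e E) Y) E) X
        + vf_mult (dual_mult M m e E) (vf_mult (dual_mult M m e E) W X) Y)"

definition dual_family_of ::
    "('a, 'e::euclidean_space) manifold \<Rightarrow> 'a tmult \<Rightarrow> 'a vfield \<Rightarrow> 'a vfield \<Rightarrow> 'a conn \<Rightarrow>
     'a conn set" where
  "dual_family_of M m e E D = {dual_conn M m e E D W | W. W \<in> vector_fields M}"

definition dual_family ::
    "('a, 'e::euclidean_space) manifold \<Rightarrow> 'a tmult \<Rightarrow> 'a vfield \<Rightarrow> 'a vfield \<Rightarrow> 'a conn set \<Rightarrow>
     'a conn set" where
  "dual_family M m e E S = dual_family_of M m e E (SOME D. D \<in> S)"

type_synonym ('a, 'e) F_structure =
  "('a, 'e) manifold \<times> 'a tmult \<times> 'a vfield \<times> 'a vfield \<times> 'a conn set"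

definition special_F_structures :: "('a, 'e::euclidean_space) F_structure set" where
  "special_F_structures =
     {(M, m, e, E, S). F_manifold M m e \<and> eventual_identity M m e E \<and> special_family M m e S}"

definition duality :: "('a, 'e::euclidean_space) F_structure \<Rightarrow> ('a, 'e) F_structure" where
  "duality = (\<lambda>(M, m, e, E, S). (M, dual_mult M m e E, E, e, dual_family M m e E S))"

definition involution_on :: "'b set \<Rightarrow> ('b \<Rightarrow> 'b) \<Rightarrow> bool" where
  "involution_on A f \<longleftrightarrow> f \<in> A \<rightarrow> A \<and> (\<forall>x\<in>A. f (f x) = x)"

end

theory Submission
  imports Defs
begin

text \<open>
  Write \<open>F\<close> for the inverse of \<open>E\<close>, \<open>D\<close> for a torsion-free compatible connection and \<open>C = D(\<circ>)\<close> for
  its totally symmetric covariant derivative of the multiplication; associativity makes \<open>C\<close> a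
  Hochschild cocycle. The unit \<open>E\<close> of the dual \<open>F\<close>-manifold satisfies \<open>L\<^sub>E(*) = 0\<close>, which, rewritten
  with \<open>D\<close> in place of brackets, computes \<open>D\<^bsub>X\<circ>Y\<^esub>(E)\<close> from \<open>C(E,X,Y)\<close>, \<open>D\<^sub>X(E)\<close>, \<open>D\<^sub>Y(E)\<close> and \<open>[e,E]\<close>.
  Substituting this into the torsion and into the covariant derivative of \<open>*\<close> for the dual
  connection leaves, besides manifestly symmetric terms, only terms in \<open>C\<close>, which are symmetric by
  the cocycle identity. The same
  computation shows that dualising twice changes \<open>D\<close> by a term \<open>U \<circ> X \<circ> Y\<close>, which does not change
  the family.
\<close>

section \<open>Smooth functions and vector fields\<close>

text \<open>On an open set derivatives depend only on the values there, so in the inductions below a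
  derivative may be replaced by a formula valid on \<open>S\<close> alone.\<close>

lemma C_k_on_cong:
  assumes "open S" "\<And>x. x \<in> S \<Longrightarrow> f x = g x"
  shows "C_k_on k S f \<longleftrightarrow> C_k_on k S g"
  using assms(2)
proof (induction k arbitrary: f g)
  case 0
  then show ?case by (simp cong: continuous_on_cong)
next
  case (Suc k)
  have der: "(f has_derivative D) (at x) \<longleftrightarrow> (g has_derivative D) (at x)" if "x \<in> S" for x D
    using has_derivative_transform_within_open[OF _ assms(1) that, of f D UNIV g]
      has_derivative_transform_within_open[OF _ assms(1) that, of g D UNIV f] Suc.prems by auto
  then have "frechet_derivative f (at x) = frechet_derivative g (at x)" if "x \<in> S" for x
    using that by (simp add: frechet_derivative_def)
  then have "C_k_on k S (\<lambda>x. frechet_derivative f (at x) v) \<longleftrightarrow>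
      C_k_on k S (\<lambda>x. frechet_derivative g (at x) v)" for v
    by (intro Suc.IH) auto
  moreover have "f differentiable (at x) \<longleftrightarrow> g differentiable (at x)" if "x \<in> S" for x
    using der that by (simp add: differentiable_def)
  ultimately show ?case by simp
qed

lemma C_k_on_SucD: "C_k_on (Suc k) S f \<Longrightarrow> C_k_on k S f"
proof (induction k arbitrary: f)
  case 0
  then show ?case
    by (metis C_k_on.simps differentiable_at_withinI differentiable_imp_continuous_on differentiable_on_def)
next
  case (Suc k)
  then show ?case by (metis C_k_on.simps(2))
qed

lemma C_k_on_const: "C_k_on k S (\<lambda>x. c)"
  by (induction k arbitrary: c) auto

lemma C_k_on_add:
  assumes "open S" "C_k_on k S f" "C_k_on k S g"
  shows "C_k_on k S (\<lambda>x. f x + g x)"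
  using assms(2,3)
proof (induction k arbitrary: f g)
  case 0
  then show ?case by (auto intro: continuous_intros)
next
  case (Suc k)
  have "frechet_derivative (\<lambda>x. f x + g x) (at x) =
      (\<lambda>v. frechet_derivative f (at x) v + frechet_derivative g (at x) v)" if "x \<in> S" for x
  proof -
    have "(f has_derivative frechet_derivative f (at x)) (at x)"
      "(g has_derivative frechet_derivative g (at x)) (at x)"
      using Suc.prems that by (auto simp: frechet_derivative_works)
    from has_derivative_add[OF this] show ?thesis
      by (rule frechet_derivative_at[symmetric])
  qed
  then have "C_k_on k S (\<lambda>x. frechet_derivative (\<lambda>x. f x + g x) (at x) v)" for v
    using Suc by (subst C_k_on_cong[OF assms(1)]) auto
  then show ?case using Suc.prems by auto
qed

lemma C_k_on_mult:
  fixes f g :: "'e::real_normed_vector \<Rightarrow> 'f::real_normed_algebra"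
  assumes "open S" "C_k_on k S f" "C_k_on k S g"
  shows "C_k_on k S (\<lambda>x. f x * g x)"
  using assms(2,3)
proof (induction k arbitrary: f g)
  case 0
  then show ?case by (auto intro: continuous_intros)
next
  case (Suc k)
  have "frechet_derivative (\<lambda>x. f x * g x) (at x) =
      (\<lambda>v. f x * frechet_derivative g (at x) v + frechet_derivative f (at x) v * g x)"
    if "x \<in> S" for x
  proof -
    have "(f has_derivative frechet_derivative f (at x)) (at x)"
      "(g has_derivative frechet_derivative g (at x)) (at x)"
      using Suc.prems that by (auto simp: frechet_derivative_works)
    from has_derivative_mult[OF this] show ?thesis
      by (rule frechet_derivative_at[symmetric])
  qed
  moreover have "C_k_on k S (\<lambda>x. f x * frechet_derivative g (at x) v + frechet_derivative f (at x) v * g x)" for v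
    using Suc.prems Suc.prems[THEN C_k_on_SucD]
    by (intro C_k_on_add[OF assms(1)] Suc.IH) auto
  ultimately have "C_k_on k S (\<lambda>x. frechet_derivative (\<lambda>x. f x * g x) (at x) v)" for v
    by (subst C_k_on_cong[OF assms(1)]) auto
  then show ?case using Suc.prems by auto
qed

section \<open>Tangent spaces and the module of vector fields\<close>

lemma tangent_space_zero: "0 \<in> tangent_space M p"
  by (simp add: tangent_space_def)

lemma tangent_space_add:
  "v \<in> tangent_space M p \<Longrightarrow> w \<in> tangent_space M p \<Longrightarrow> v + w \<in> tangent_space M p"
  by (simp add: tangent_space_def algebra_simps)

lemma tangent_space_tscale: "v \<in> tangent_space M p \<Longrightarrow> tscale c v \<in> tangent_space M p"
  by (simp add: tangent_space_def tscale_def algebra_simps)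

context
  fixes M :: "('a, 'e::euclidean_space) manifold"
  assumes M: "smooth_manifold M"
begin

lemma smooth_funs_add: "f \<in> smooth_funs M \<Longrightarrow> g \<in> smooth_funs M \<Longrightarrow> f + g \<in> smooth_funs M"
  using M C_k_on_add
  by (fastforce simp: smooth_funs_def smooth_on_def o_def smooth_manifold_def)

lemma smooth_funs_mult: "f \<in> smooth_funs M \<Longrightarrow> g \<in> smooth_funs M \<Longrightarrow> f * g \<in> smooth_funs M"
  using M C_k_on_mult
  by (fastforce simp: smooth_funs_def smooth_on_def o_def smooth_manifold_def)

lemma smooth_funs_cmult: "f \<in> smooth_funs M \<Longrightarrow> (\<lambda>x. c * f x) \<in> smooth_funs M"
  using M C_k_on_mult[OF _ C_k_on_const]
  by (fastforce simp: smooth_funs_def smooth_on_def o_def smooth_manifold_def)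

lemma vector_fields_zero: "0 \<in> vector_fields M"
  using smooth_funs_cmult[of _ 0]
  by (auto simp: vector_fields_def tangent_space_zero vf_apply_def)

lemma vector_fields_add:
  assumes "X \<in> vector_fields M" "Y \<in> vector_fields M"
  shows "X + Y \<in> vector_fields M"
proof -
  have "vf_apply (X + Y) f = vf_apply X f + vf_apply Y f" for f
    by (simp add: vf_apply_def fun_eq_iff)
  with assms show ?thesis
    by (simp add: vector_fields_def tangent_space_add smooth_funs_add)
qed

lemma vector_fields_uminus:
  assumes "X \<in> vector_fields M"
  shows "- X \<in> vector_fields M"
proof -
  have "vf_apply (- X) f = (\<lambda>x. - 1 * vf_apply X f x)" "(- X) p = tscale (- 1) (X p)" for f p
    by (simp_all add: vf_apply_def tscale_def fun_eq_iff)
  with assms show ?thesis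
    using smooth_funs_cmult[of _ "- 1"]
    by (simp add: vector_fields_def tangent_space_tscale)
qed

lemma vector_fields_scale:
  assumes "f \<in> smooth_funs M" "X \<in> vector_fields M"
  shows "vf_scale f X \<in> vector_fields M"
proof -
  have "vf_apply (vf_scale f X) g = f * vf_apply X g" for g
    by (simp add: vf_apply_def vf_scale_def tscale_def fun_eq_iff)
  with assms show ?thesis
    by (simp add: vector_fields_def tangent_space_tscale smooth_funs_mult)
       (auto simp: vf_scale_def tangent_space_tscale, simp add: tscale_def zero_fun_def)
qed

end

section \<open>The algebra of compatible connections\<close>

text \<open>An abstract model of vector fields in which \<open>D\<close> is biadditive; linearity
  over functions is treated in \<open>connection_dual\<close>. Commutativity and associativity range
  over the whole type, so they rewrite without membership conditions.\<close>

locale mult_conn =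
  fixes V :: "'r::ab_group_add set"
    and mul :: "'r \<Rightarrow> 'r \<Rightarrow> 'r" (infixl "\<odot>" 70)
    and e E F :: 'r
    and D :: "'r \<Rightarrow> 'r \<Rightarrow> 'r"
  assumes zero_closed [simp]: "0 \<in> V"
    and add_closed [simp]: "X \<in> V \<Longrightarrow> Y \<in> V \<Longrightarrow> X + Y \<in> V"
    and uminus_closed [simp]: "X \<in> V \<Longrightarrow> - X \<in> V"
    and mul_closed [simp]: "X \<in> V \<Longrightarrow> Y \<in> V \<Longrightarrow> X \<odot> Y \<in> V"
    and mul_commute: "X \<odot> Y = Y \<odot> X"
    and mul_assoc: "X \<odot> Y \<odot> Z = X \<odot> (Y \<odot> Z)"
    and distrib_right: "X \<in> V \<Longrightarrow> Y \<in> V \<Longrightarrow> Z \<in> V \<Longrightarrow> (X + Y) \<odot> Z = X \<odot> Z + Y \<odot> Z"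
    and e_closed [simp]: "e \<in> V" and E_closed [simp]: "E \<in> V" and F_closed [simp]: "F \<in> V"
    and unit [simp]: "X \<in> V \<Longrightarrow> e \<odot> X = X"
    and inverse: "E \<odot> F = e"
    and D_closed [simp]: "X \<in> V \<Longrightarrow> Y \<in> V \<Longrightarrow> D X Y \<in> V"
    and D_add_left: "X \<in> V \<Longrightarrow> Y \<in> V \<Longrightarrow> Z \<in> V \<Longrightarrow> D (X + Y) Z = D X Z + D Y Z"
    and D_add_right: "X \<in> V \<Longrightarrow> Y \<in> V \<Longrightarrow> Z \<in> V \<Longrightarrow> D X (Y + Z) = D X Y + D X Z"
begin

lemma diff_closed [simp]: "X \<in> V \<Longrightarrow> Y \<in> V \<Longrightarrow> X - Y \<in> V"
  using add_closed[of X "- Y"] by simp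

lemma mul_left_commute: "X \<odot> (Y \<odot> Z) = Y \<odot> (X \<odot> Z)"
  by (metis mul_assoc mul_commute)

lemmas mul_ac = mul_assoc mul_commute mul_left_commute

lemma unit_right [simp]: "X \<in> V \<Longrightarrow> X \<odot> e = X"
  by (simp add: mul_commute[of X])

lemma inverse_left [simp]: "X \<in> V \<Longrightarrow> E \<odot> (F \<odot> X) = X" "X \<in> V \<Longrightarrow> F \<odot> (E \<odot> X) = X"
  by (metis inverse mul_assoc unit) (metis inverse mul_assoc mul_commute unit)

lemma inverse' [simp]: "E \<odot> F = e" "F \<odot> E = e"
  by (auto simp: inverse mul_commute[of F E])

lemma distrib_left: "X \<in> V \<Longrightarrow> Y \<in> V \<Longrightarrow> Z \<in> V \<Longrightarrow> Z \<odot> (X + Y) = Z \<odot> X + Z \<odot> Y"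
  by (metis distrib_right mul_commute)

lemma diff_right: "X \<in> V \<Longrightarrow> Y \<in> V \<Longrightarrow> Z \<in> V \<Longrightarrow> (X - Y) \<odot> Z = X \<odot> Z - Y \<odot> Z"
  by (metis add_diff_cancel diff_add_cancel diff_closed distrib_right)

lemma diff_left: "X \<in> V \<Longrightarrow> Y \<in> V \<Longrightarrow> Z \<in> V \<Longrightarrow> Z \<odot> (X - Y) = Z \<odot> X - Z \<odot> Y"
  by (metis diff_right mul_commute)

lemma zero_mul: "X \<in> V \<Longrightarrow> 0 \<odot> X = 0"
  using distrib_right[of 0 0 X] by simp

lemmas distribs = distrib_left distrib_right diff_left diff_right

definition C :: "'r \<Rightarrow> 'r \<Rightarrow> 'r \<Rightarrow> 'r" where
  "C X Y Z = D X (Y \<odot> Z) - D X Y \<odot> Z - Y \<odot> D X Z"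

lemma C_closed [simp]: "X \<in> V \<Longrightarrow> Y \<in> V \<Longrightarrow> Z \<in> V \<Longrightarrow> C X Y Z \<in> V"
  by (simp add: C_def)

lemma D_mul: "D X (Y \<odot> Z) = C X Y Z + D X Y \<odot> Z + Y \<odot> D X Z"
  by (simp add: C_def)

text \<open>Differentiating associativity shows that the covariant derivative of the multiplication
  is a Hochschild cocycle.\<close>

lemma C_cocycle:
  assumes "X \<in> V" "a \<in> V" "b \<in> V" "c \<in> V"
  shows "C X (a \<odot> b) c + C X a b \<odot> c = C X a (b \<odot> c) + a \<odot> C X b c"
  using assms by (simp add: C_def distribs mul_assoc algebra_simps)

text \<open>The member \<open>W = 0\<close> of the dual family.\<close>

definition dualD :: "'r \<Rightarrow> 'r \<Rightarrow> 'r" where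
  "dualD X Y = E \<odot> D X (F \<odot> Y) - D (F \<odot> Y) E \<odot> X"

lemma dualD_closed [simp]: "X \<in> V \<Longrightarrow> Y \<in> V \<Longrightarrow> dualD X Y \<in> V"
  by (simp add: dualD_def)

end

text \<open>The last assumption says that the Lie derivative of the dual multiplication along its unit
  \<open>E\<close> vanishes, the brackets being those of the torsion-free connection \<open>D\<close>.\<close>

locale eventual_conn = mult_conn +
  assumes C_sym12: "X \<in> V \<Longrightarrow> Y \<in> V \<Longrightarrow> Z \<in> V \<Longrightarrow> C X Y Z = C Y X Z"
    and C_sym23: "X \<in> V \<Longrightarrow> Y \<in> V \<Longrightarrow> Z \<in> V \<Longrightarrow> C X Y Z = C X Z Y"
    and eventual: "X \<in> V \<Longrightarrow> Y \<in> V \<Longrightarrow>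
      D E (X \<odot> Y \<odot> F) - D (X \<odot> Y \<odot> F) E
      = (D E X - D X E) \<odot> Y \<odot> F + X \<odot> (D E Y - D Y E) \<odot> F"
begin

section \<open>Torsion and compatibility of the dual connection, and the double dual\<close>

definition k :: 'a where "k = D e E - D E e"

lemma k_closed [simp]: "k \<in> V"
  by (simp add: k_def)

text \<open>Bracketing with \<open>E\<close> is a derivation of the product up to a term in
  \<open>k\<close>, the bracket \<open>[e, E]\<close>; expanding \<open>D E (X \<odot> Y)\<close>
  through \<open>C\<close> isolates the remaining term.\<close>

lemma D_mul_E:
  assumes "X \<in> V" "Y \<in> V"
  shows "D (X \<odot> Y) E = C E X Y + D X E \<odot> Y + X \<odot> D Y E - k \<odot> (X \<odot> Y)"
proof -
  let ?B = "\<lambda>Y. D E Y - D Y E"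
  \<comment> \<open>Putting \<open>E \<odot> Y\<close> for \<open>Y\<close> in
    \<open>eventual\<close> cancels the factor \<open>F\<close>.\<close>
  have *: "?B (X \<odot> Y) = ?B X \<odot> Y + X \<odot> (F \<odot> ?B (E \<odot> Y))" if "X \<in> V" for X
    using eventual[of X "E \<odot> Y"] that assms by (simp add: mul_ac)
  \<comment> \<open>The case \<open>X = e\<close>, where \<open>?B e = - k\<close>.\<close>
  have "F \<odot> ?B (E \<odot> Y) = ?B Y + k \<odot> Y"
    using *[of e] assms by (simp add: k_def distribs algebra_simps)
  with *[of X] assms have "?B (X \<odot> Y) = ?B X \<odot> Y + X \<odot> (?B Y + k \<odot> Y)"
    by simp
  then show ?thesis
    using assms by (simp add: C_def distribs mul_left_commute[of X k] algebra_simps)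
qed

text \<open>With \<open>X = E \<odot> x\<close> and \<open>Y = E \<odot> y\<close>, the difference
  \<open>dualD X Y - D X Y\<close> becomes symmetric in \<open>x\<close> and \<open>y\<close>, so
  antisymmetrising removes it.\<close>

lemma dualD_torsion:
  assumes "X \<in> V" "Y \<in> V"
  shows "dualD X Y - dualD Y X = D X Y - D Y X"
proof -
  have expand: "dualD X Y - D X Y =
      - (D E E \<odot> (x \<odot> y) + D x E \<odot> (E \<odot> y) + D y E \<odot> (E \<odot> x) - k \<odot> (E \<odot> (x \<odot> y)))
      - (C E E (x \<odot> y) + E \<odot> C E x y)"
    if [simp]: "x \<in> V" "y \<in> V" and X: "X = E \<odot> x" and Y: "Y = E \<odot> y" for x y X Y
  proof -
    \<comment> \<open>The only asymmetric term here, \<open>C E E x \<odot> y\<close>, cancels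
      against the same term in \<open>3\<close>.\<close>
    have 1: "C E X y = C E E (x \<odot> y) + E \<odot> C E x y - C E E x \<odot> y"
      using C_cocycle[of E E x y] by (simp add: X eq_diff_eq)
    have 2: "dualD X Y = D X Y - C E X y - D X E \<odot> y - D y E \<odot> X"
      using D_mul[of X E y] C_sym12[of X E y] by (simp add: dualD_def X Y)
    have 3: "D X E \<odot> y = C E E x \<odot> y + D E E \<odot> (x \<odot> y) + D x E \<odot> (E \<odot> y) - k \<odot> (E \<odot> (x \<odot> y))"
      by (simp add: X D_mul_E distribs mul_ac)
    have 4: "D y E \<odot> X = D y E \<odot> (E \<odot> x)"
      by (simp add: X)
    show ?thesis
      unfolding 2 1 3 4 by (simp add: algebra_simps)
  qed
  have "C E (F \<odot> X) (F \<odot> Y) = C E (F \<odot> Y) (F \<odot> X)"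
    using assms by (intro C_sym23) simp_all
  moreover have "(F \<odot> X) \<odot> (F \<odot> Y) = (F \<odot> Y) \<odot> (F \<odot> X)"
    by (rule mul_commute)
  ultimately have "dualD X Y - D X Y = dualD Y X - D Y X"
    using expand[of "F \<odot> X" "F \<odot> Y" X Y] expand[of "F \<odot> Y" "F \<odot> X" Y X] assms
    by (simp add: add.commute)
  then show ?thesis
    by (simp add: algebra_simps)
qed

text \<open>The covariant derivative under \<open>dualD\<close> of the dual product
  \<open>X \<odot> Y \<odot> F\<close>.\<close>

definition dualC :: "'a \<Rightarrow> 'a \<Rightarrow> 'a \<Rightarrow> 'a" where
  "dualC X Y Z = dualD X (Y \<odot> Z \<odot> F) - dualD X Y \<odot> Z \<odot> F - Y \<odot> dualD X Z \<odot> F"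

text \<open>By \<open>D_mul_E\<close> the derivatives of \<open>E\<close> along \<open>y\<close> and
  \<open>z\<close> cancel, so only \<open>C\<close> and a symmetric term in \<open>k\<close>
  survive.\<close>

lemma dualC_eq:
  assumes [simp]: "x \<in> V" "y \<in> V" "z \<in> V"
  shows "dualC (E \<odot> x) (E \<odot> y) (E \<odot> z)
    = E \<odot> (C z (E \<odot> x) y - x \<odot> C z E y) + k \<odot> (E \<odot> (x \<odot> (y \<odot> z)))"
proof -
  have 1: "dualD (E \<odot> x) (E \<odot> y \<odot> (E \<odot> z) \<odot> F)
      = E \<odot> D (E \<odot> x) (y \<odot> z) - D (y \<odot> z) E \<odot> (E \<odot> x)"
    by (simp add: dualD_def mul_ac)
  have 2: "dualD (E \<odot> x) (E \<odot> y) \<odot> (E \<odot> z) \<odot> F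
      = E \<odot> (D (E \<odot> x) y \<odot> z) - D y E \<odot> (E \<odot> (x \<odot> z))"
    by (simp add: dualD_def distribs mul_ac)
  have 3: "E \<odot> y \<odot> dualD (E \<odot> x) (E \<odot> z) \<odot> F
      = E \<odot> (y \<odot> D (E \<odot> x) z) - D z E \<odot> (E \<odot> (x \<odot> y))"
    by (simp add: dualD_def distribs mul_ac)
  \<comment> \<open>Symmetry moves \<open>z\<close> into the direction slot, so that a single
    cocycle identity along \<open>z\<close> can handle the exchange of \<open>x\<close> and
    \<open>y\<close>.\<close>
  have 4: "C (E \<odot> x) y z = C z (E \<odot> x) y" "C E y z = C z E y"
    using C_sym12 C_sym23 by simp_all
  show ?thesis
    unfolding dualC_def 1 2 3 D_mul_E[OF assms(2,3)] D_mul[of "E \<odot> x" y z] 4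
    by (simp add: distribs mul_ac algebra_simps)
qed

text \<open>Exchanging \<open>x\<close> and \<open>y\<close> in \<open>dualC_eq\<close> is the
  cocycle identity for \<open>x\<close>, \<open>E\<close>, \<open>y\<close>; exchanging the last two
  arguments is commutativity of the product.\<close>

lemma dualC_sym:
  assumes [simp]: "X \<in> V" "Y \<in> V" "Z \<in> V"
  shows "dualC X Y Z = dualC Y X Z" "dualC X Y Z = dualC X Z Y"
proof -
  define x y z where xyz: "x = F \<odot> X" "y = F \<odot> Y" "z = F \<odot> Z"
  have [simp]: "x \<in> V" "y \<in> V" "z \<in> V" and X: "X = E \<odot> x" "Y = E \<odot> y" "Z = E \<odot> z"
    by (simp_all add: xyz)
  have "C z (x \<odot> E) y + C z x E \<odot> y = C z x (E \<odot> y) + x \<odot> C z E y"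
    by (rule C_cocycle) simp_all
  moreover have "C z x E = C z E x" "C z x (E \<odot> y) = C z (E \<odot> y) x"
    by (simp_all add: C_sym23)
  ultimately have "C z (E \<odot> x) y - x \<odot> C z E y = C z (E \<odot> y) x - y \<odot> C z E x"
    by (simp add: mul_commute[of x E] mul_commute[of y] algebra_simps)
  then show "dualC X Y Z = dualC Y X Z"
    by (simp add: X dualC_eq mul_left_commute[of x y])
  show "dualC X Y Z = dualC X Z Y"
    by (simp add: dualC_def mul_ac)
qed

text \<open>The cocycle identity with two units pulls \<open>Y\<close> out of
  \<open>C X Y e\<close>; symmetry of \<open>C\<close> then turns dependence on the direction
  \<open>X\<close> into multiplication by \<open>X\<close>.\<close>

lemma D_e:
  assumes "X \<in> V"
  shows "D X e = - (X \<odot> C e e e)"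
proof -
  have *: "C X Y e = Y \<odot> C X e e" if "X \<in> V" "Y \<in> V" for X Y
    using C_cocycle[of X Y e e] that by simp
  have "D X e = - C X e e"
    using assms by (simp add: C_def)
  also have "C X e e = C e X e"
    using assms by (simp add: C_sym12)
  finally show ?thesis
    using *[of e X] assms by simp
qed

text \<open>The field by which dualising twice displaces \<open>D\<close>. Its two copies of
  \<open>E \<odot> C e e e\<close> come from \<open>D_e\<close> and from the cocycle
  identity.\<close>

definition shift :: 'a where
  "shift = D F E + F \<odot> (E \<odot> C e e e + F \<odot> D E E - k + C E E F + E \<odot> C e e e)"

lemma shift_closed [simp]: "shift \<in> V"
  by (simp add: shift_def)

text \<open>The left side is the dual construction applied to \<open>dualD\<close>: under the dual
  product \<open>e\<close> acts as \<open>F\<close>, and the inverse of \<open>e\<close> acts as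
  \<open>E\<close>.\<close>

lemma dualD_dualD:
  assumes [simp]: "X \<in> V" "Y \<in> V"
  shows "F \<odot> dualD X (E \<odot> Y) - F \<odot> (dualD (E \<odot> Y) e \<odot> X) = D X Y + shift \<odot> X \<odot> Y"
proof -
  \<comment> \<open>\<open>T\<close> gathers the terms not visibly multiples of \<open>Y\<close>;
    the aim is to show that it is one too.\<close>
  define T where "T = F \<odot> D Y E + D (E \<odot> Y) F"
  have "C E Y e = Y \<odot> (E \<odot> C e e e)"
    using C_cocycle[of E Y e e] D_e[of E] by (simp add: C_def)
  then have c: "C E (E \<odot> Y) F + F \<odot> C E E Y = Y \<odot> (E \<odot> C e e e) + Y \<odot> C E E F"
    using C_cocycle[of E Y E F] C_sym23[of E Y E] by (simp add: mul_ac)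
  \<comment> \<open>Differentiating \<open>E \<odot> F = e\<close> along \<open>E \<odot> Y\<close>
    gives access to the derivative of \<open>F\<close> in \<open>T\<close>.\<close>
  have "D (E \<odot> Y) e = C E (E \<odot> Y) F + D (E \<odot> Y) E \<odot> F + E \<odot> D (E \<odot> Y) F"
    using D_mul[of "E \<odot> Y" E F] C_sym12[of "E \<odot> Y" E F] by simp
  moreover have "D (E \<odot> Y) E \<odot> F = F \<odot> C E E Y + F \<odot> (D E E \<odot> Y) + D Y E - k \<odot> Y"
    by (simp add: D_mul_E distribs mul_ac)
  ultimately have "E \<odot> T = - (E \<odot> (Y \<odot> C e e e)) - (C E (E \<odot> Y) F + F \<odot> C E E Y)
       - F \<odot> (D E E \<odot> Y) + k \<odot> Y"
    by (simp add: T_def D_e distribs mul_ac algebra_simps)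
  then have "F \<odot> (E \<odot> T) = F \<odot> (- (E \<odot> (Y \<odot> C e e e)) - (Y \<odot> (E \<odot> C e e e) + Y \<odot> C E E F)
       - F \<odot> (D E E \<odot> Y) + k \<odot> Y)"
    by (simp add: c)
  then have T: "T = F \<odot> (- (E \<odot> (Y \<odot> C e e e)) - (Y \<odot> (E \<odot> C e e e) + Y \<odot> C E E F)
       - F \<odot> (D E E \<odot> Y) + k \<odot> Y)"
    by (simp add: T_def)
  have dd: "F \<odot> dualD X (E \<odot> Y) - F \<odot> (dualD (E \<odot> Y) e \<odot> X)
      = D X Y - X \<odot> T + X \<odot> (D F E \<odot> Y)"
    by (simp add: T_def dualD_def distribs mul_ac algebra_simps)
  show ?thesis
    unfolding dd T by (simp add: shift_def distribs mul_ac algebra_simps)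
qed

end

section \<open>Duality\<close>

context
  fixes M :: "('a, 'e::euclidean_space) manifold" and m :: "'a tmult"
  assumes m: "tangent_mult M m"
begin

lemma tangent_mult_outside:
  "\<not> (p \<in> points M \<and> v \<in> tangent_space M p \<and> w \<in> tangent_space M p) \<Longrightarrow> m p v w = 0"
  using m unfolding tangent_mult_def by blast

lemma tangent_mult_inside:
  assumes "p \<in> points M" "u \<in> tangent_space M p" "v \<in> tangent_space M p" "w \<in> tangent_space M p"
  shows "m p u v \<in> tangent_space M p" "m p u v = m p v u" "m p (m p u v) w = m p u (m p v w)"
    "m p (u + v) w = m p u w + m p v w" "m p (tscale c u) v = tscale c (m p u v)"
  using m assms unfolding tangent_mult_def by blast+

lemma tangent_mult_zero: "m p 0 v = 0"
proof (cases "p \<in> points M \<and> v \<in> tangent_space M p")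
  case True
  then have "m p (0 + 0) v = m p 0 v + m p 0 v"
    by (intro tangent_mult_inside tangent_space_zero) auto
  then show ?thesis by simp
qed (auto intro: tangent_mult_outside)

text \<open>Commutativity and associativity hold even for arguments that are not tangent vectors,
  where both sides have the junk value \<open>0\<close>.\<close>

lemma tangent_mult_commute: "m p v w = m p w v"
proof (cases "p \<in> points M \<and> v \<in> tangent_space M p \<and> w \<in> tangent_space M p")
  case False
  then have "m p v w = 0" "m p w v = 0"
    by (auto intro!: tangent_mult_outside)
  then show ?thesis by simp
qed (auto intro: tangent_mult_inside)

lemma tangent_mult_assoc: "m p (m p u v) w = m p u (m p v w)"
proof (cases "p \<in> points M \<and> u \<in> tangent_space M p \<and> v \<in> tangent_space M p \<and> w \<in> tangent_space M p")
  case False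
  then have "m p u v = 0 \<or> m p (m p u v) w = 0" "m p v w = 0 \<or> m p u (m p v w) = 0"
    using tangent_mult_outside by blast+
  then have "m p (m p u v) w = 0" "m p u (m p v w) = 0"
    using tangent_mult_zero[of p w] tangent_mult_zero[of p u] tangent_mult_commute[of p u 0] by auto
  then show ?thesis by simp
qed (auto intro: tangent_mult_inside)

lemma vf_mult_closed:
  "X \<in> vector_fields M \<Longrightarrow> Y \<in> vector_fields M \<Longrightarrow> vf_mult m X Y \<in> vector_fields M"
  using m by (simp add: tangent_mult_def)

lemma vf_mult_commute: "vf_mult m X Y = vf_mult m Y X"
  using tangent_mult_commute by (auto simp: vf_mult_def)

lemma vf_mult_assoc: "vf_mult m (vf_mult m X Y) Z = vf_mult m X (vf_mult m Y Z)"
  using tangent_mult_assoc by (auto simp: vf_mult_def)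

lemma vf_mult_add:
  assumes "X \<in> vector_fields M" "Y \<in> vector_fields M" "Z \<in> vector_fields M"
  shows "vf_mult m (X + Y) Z = vf_mult m X Z + vf_mult m Y Z"
proof
  fix p
  show "vf_mult m (X + Y) Z p = (vf_mult m X Z + vf_mult m Y Z) p"
    using assms m by (cases "p \<in> points M") (auto simp: vf_mult_def tangent_mult_def vector_fields_def)
qed

lemma vf_mult_scale:
  assumes "X \<in> vector_fields M" "Y \<in> vector_fields M"
  shows "vf_mult m (vf_scale f X) Y = vf_scale f (vf_mult m X Y)"
proof
  fix p
  show "vf_mult m (vf_scale f X) Y p = vf_scale f (vf_mult m X Y) p"
  proof (cases "p \<in> points M")
    case True
    with assms m show ?thesis
      by (auto simp: vf_mult_def vf_scale_def tangent_mult_def vector_fields_def)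
  next
    case False
    with m have "m p v w = 0" for v w by (simp add: tangent_mult_def)
    then show ?thesis by (simp add: vf_mult_def vf_scale_def tscale_def fun_eq_iff)
  qed
qed

lemma vf_mult_scale_right:
  assumes "X \<in> vector_fields M" "Y \<in> vector_fields M"
  shows "vf_mult m X (vf_scale f Y) = vf_scale f (vf_mult m X Y)"
  using vf_mult_scale[OF assms(2,1)] by (simp add: vf_mult_commute[of X])

lemma vf_mult_unit:
  assumes "unit_field M m e" "X \<in> vector_fields M"
  shows "vf_mult m e X = X"
proof
  fix p
  show "vf_mult m e X p = X p"
    using assms m by (cases "p \<in> points M")
      (auto simp: vf_mult_def tangent_mult_def unit_field_def vector_fields_def)
qed

text \<open>Inverses are unique by associativity and commutativity, so the definite description
  equals any inverse that can be exhibited.\<close>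

lemma inverse_field_eqI:
  assumes "unit_field M m e" "E \<in> vector_fields M" "X \<in> vector_fields M" "vf_mult m E X = e"
  shows "inverse_field M m e E = X"
  unfolding inverse_field_def
proof (rule the_equality)
  fix Y
  assume Y: "Y \<in> vector_fields M \<and> vf_mult m E Y = e"
  have "Y = vf_mult m (vf_mult m E X) Y"
    using Y assms by (simp add: vf_mult_unit)
  also have "\<dots> = vf_mult m (vf_mult m E Y) X"
    by (metis vf_mult_assoc vf_mult_commute)
  also have "\<dots> = X"
    using Y assms by (simp add: vf_mult_unit)
  finally show "Y = X" .
qed (use assms in simp)

end

lemma vf_scale_add: "vf_scale f (X + Y) = vf_scale f X + vf_scale f Y"
  by (simp add: vf_scale_def tscale_def fun_eq_iff algebra_simps)

lemma vf_scale_diff: "vf_scale f (X - Y) = vf_scale f X - vf_scale f Y"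
  by (simp add: vf_scale_def tscale_def fun_eq_iff algebra_simps)

lemma vf_mult_dual_mult:
  "vf_mult (dual_mult M m e E) X Y = vf_mult m (vf_mult m X Y) (inverse_field M m e E)"
  by (simp add: vf_mult_def dual_mult_def)

text \<open>The defining identity at \<open>X = Y = e\<close> gives \<open>L\<^sub>e(\<circ>) = 2 L\<^sub>e(\<circ>)\<close>.\<close>

lemma lie_mult_unit:
  assumes "F_manifold M m e" "X \<in> vector_fields M" "Y \<in> vector_fields M"
    and "lie_mult m e X Y \<in> vector_fields M"
  shows "lie_mult m e X Y = 0"
proof -
  have m: "tangent_mult M m" and u: "unit_field M m e" and e: "e \<in> vector_fields M"
    using assms(1) by (auto simp: F_manifold_def unit_field_def)
  have "lie_mult m (vf_mult m e e) X Y =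
      vf_mult m e (lie_mult m e X Y) + vf_mult m e (lie_mult m e X Y)"
    using assms e by (simp add: F_manifold_def)
  then show ?thesis
    using assms(4) by (simp add: vf_mult_unit[OF m u] e)
qed

section \<open>The dual F-manifold and its dual\<close>

locale eventual_F_manifold =
  fixes M :: "('a, 'e::euclidean_space) manifold" and m :: "'a tmult" and e E :: "'a vfield"
  assumes ev: "eventual_identity M m e E"
begin

abbreviation "VF \<equiv> vector_fields M"
abbreviation "F \<equiv> inverse_field M m e E"
abbreviation "dm \<equiv> dual_mult M m e E"

lemma smooth: "smooth_manifold M"
  and tm: "tangent_mult M m" and tm_dual: "tangent_mult M dm"
  and unit: "unit_field M m e" and unit_dual: "unit_field M dm E"
  and fm: "F_manifold M m e" and fm_dual: "F_manifold M dm E"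
  using ev by (auto simp: eventual_identity_def F_manifold_def)

lemma e_in: "e \<in> VF" and E_in: "E \<in> VF"
  using unit unit_dual by (auto simp: unit_field_def)

lemma F_in: "F \<in> VF" and EF: "vf_mult m E F = e"
proof -
  obtain G where G: "G \<in> VF" "vf_mult m E G = e"
    using ev by (auto simp: eventual_identity_def invertible_field_def)
  then have "F = G" using inverse_field_eqI[OF tm unit E_in] by simp
  with G show "F \<in> VF" "vf_mult m E F = e" by simp_all
qed

text \<open>Exhibits the inverse of \<open>e\<close> for the dual product, whose unit is
  \<open>E\<close>.\<close>

lemma dual_mult_square: "vf_mult dm e (vf_mult m E E) = E"
proof -
  have "vf_mult m (vf_mult m E E) F = vf_mult m (vf_mult m E F) E"
    by (metis vf_mult_assoc[OF tm] vf_mult_commute[OF tm])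
  also have "\<dots> = E"
    by (simp add: EF vf_mult_unit[OF tm unit] E_in)
  finally show ?thesis
    by (simp add: vf_mult_dual_mult vf_mult_unit[OF tm unit] vf_mult_closed[OF tm] E_in)
qed

lemma inverse_dual: "inverse_field M dm E e = vf_mult m E E"
  by (rule inverse_field_eqI[OF tm_dual unit_dual e_in _ dual_mult_square])
    (simp add: vf_mult_closed[OF tm] E_in)

text \<open>Dualising twice inserts the square of \<open>E\<close> and the square of
  \<open>F\<close>, which cancel.\<close>

lemma dual_mult_dual: "dual_mult M dm E e = m"
proof -
  have "dual_mult M dm E e p v w = m p v w" for p v w
  proof -
    note ac = tangent_mult_assoc[OF tm] tangent_mult_commute[OF tm]
    have "dual_mult M dm E e p v w = m p (m p (m p (m p v w) (F p)) (m p (E p) (E p))) (F p)"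
      by (simp add: dual_mult_def[of M dm] inverse_dual) (simp add: vf_mult_def dual_mult_def)
    also have "\<dots> = m p (m p (m p (E p) (F p)) (m p (E p) (F p))) (m p v w)"
      by (metis ac)
    also have "\<dots> = m p (m p (e p) (e p)) (m p v w)"
      using EF by (simp add: vf_mult_def fun_eq_iff[of _ e])
    also have "\<dots> = m p v w"
    proof (cases "p \<in> points M \<and> v \<in> tangent_space M p \<and> w \<in> tangent_space M p")
      case True
      moreover from this have "e p \<in> tangent_space M p" "m p v w \<in> tangent_space M p"
        using e_in tm by (auto simp: vector_fields_def tangent_mult_def)
      ultimately show ?thesis
        using unit by (simp add: unit_field_def)
    next
      \<comment> \<open>For arguments that are not tangent vectors both sides have the default value
        \<open>0\<close>.\<close>
      case False
      then have "m p v w = 0" using tm by (auto simp: tangent_mult_def)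
      then show ?thesis
        using tangent_mult_zero[OF tm] tangent_mult_commute[OF tm] by metis
    qed
    finally show ?thesis .
  qed
  then show ?thesis
    by (intro ext) simp
qed

text \<open>By \<open>dual_mult_dual\<close> the dual of the dual is the original F-manifold, which
  supplies the last condition.\<close>

lemma dual: "eventual_identity M dm E e"
proof -
  show ?thesis
    using dual_mult_square e_in E_in fm fm_dual
    by (auto simp: eventual_identity_def invertible_field_def dual_mult_dual intro: vf_mult_closed[OF tm])
qed

end

section \<open>The dual connection on vector fields\<close>

locale eventual_special = eventual_F_manifold M m e E
  for M :: "('a, 'e::euclidean_space) manifold" and m e E +
  fixes D :: "'a conn"
  assumes conn: "connection M D" and tf: "torsion_free M D" and comp: "compatible M m D"
begin

lemma D_in: "X \<in> VF \<Longrightarrow> Y \<in> VF \<Longrightarrow> D X Y \<in> VF"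
  using conn by (auto simp: connection_def)

lemma lie_bracket_eq: "X \<in> VF \<Longrightarrow> Y \<in> VF \<Longrightarrow> lie_bracket X Y = D X Y - D Y X"
  using tf by (simp add: torsion_free_def)

sublocale mult_conn VF "vf_mult m" e E F D
  using conn e_in E_in F_in EF
  by unfold_locales
    (auto simp: vector_fields_zero[OF smooth] vector_fields_add[OF smooth]
      vector_fields_uminus[OF smooth] vf_mult_closed[OF tm] vf_mult_add[OF tm]
      vf_mult_assoc[OF tm] vf_mult_unit[OF tm unit] D_in connection_def
      intro: vf_mult_commute[OF tm])

lemma C_eq: "C = cov_mult m D"
  by (simp add: fun_eq_iff C_def cov_mult_def)

text \<open>Torsion-freeness turns brackets into differences of \<open>D\<close>, so
  \<open>eventual\<close> is the vanishing of the Lie derivative of \<open>dm\<close> along its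
  unit.\<close>

sublocale eventual_conn VF "vf_mult m" e E F D
proof
  fix X Y Z
  assume XY: "X \<in> VF" "Y \<in> VF"
  show "C X Y Z = C Y X Z" "C X Y Z = C X Z Y" if "Z \<in> VF"
    using comp XY that by (auto simp: C_eq compatible_def)
  have L: "lie_mult dm E X Y = D E (vf_mult m (vf_mult m X Y) F) - D (vf_mult m (vf_mult m X Y) F) E
      - vf_mult m (vf_mult m (D E X - D X E) Y) F - vf_mult m (vf_mult m X (D E Y - D Y E)) F"
    using XY by (simp add: lie_mult_def vf_mult_dual_mult lie_bracket_eq)
  \<comment> \<open>\<open>L\<close> also shows that this Lie derivative is a vector field, as
    \<open>lie_mult_unit\<close> demands.\<close>
  have "lie_mult dm E X Y = 0"
    by (rule lie_mult_unit[OF fm_dual XY]) (simp add: L XY)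
  with L show "D E (vf_mult m (vf_mult m X Y) F) - D (vf_mult m (vf_mult m X Y) F) E
      = vf_mult m (vf_mult m (D E X - D X E) Y) F + vf_mult m (vf_mult m X (D E Y - D Y E)) F"
    by (simp add: algebra_simps)
qed

abbreviation "D' \<equiv> dual_conn M m e E D 0"

lemma dual_conn_eq:
  assumes "X \<in> VF" "Y \<in> VF"
  shows "dual_conn M m e E D W X Y = dualD X Y + vf_mult dm (vf_mult dm W X) Y"
  using assms by (simp add: dual_conn_def dualD_def)

lemma D'_eq:
  assumes "X \<in> VF" "Y \<in> VF"
  shows "D' X Y = dualD X Y"
proof -
  have zero: "vf_mult dm 0 Z = 0" for Z
    by (simp add: vf_mult_def tangent_mult_zero[OF tm_dual] fun_eq_iff)
  show ?thesis
    unfolding dual_conn_eq[OF assms] zero by simp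
qed

text \<open>Brings the dual family into the form demanded by \<open>special_family\<close>, with
  base connection \<open>D'\<close>.\<close>

lemma dual_conn_shifted_conn: "dual_conn M m e E D W = shifted_conn M dm D' W"
proof (rule ext, rule ext)
  fix X Y
  show "dual_conn M m e E D W X Y = shifted_conn M dm D' W X Y"
    by (cases "X \<in> VF \<and> Y \<in> VF")
      (simp add: shifted_conn_def D'_eq dual_conn_eq[of X Y W], auto simp: shifted_conn_def dual_conn_def)
qed

text \<open>In the second slot only \<open>E \<odot> D X (F \<odot> Y)\<close> differentiates a
  factor \<open>f\<close>, and there \<open>E\<close> and \<open>F\<close> cancel; the other term
  has \<open>Y\<close> in the direction slot and is linear over functions.\<close>

lemma connection_dual: "connection M D'"
proof -
  have D'_pi: "D' \<in> VF \<rightarrow>\<^sub>E VF \<rightarrow>\<^sub>E VF"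
  proof -
    have "D' X Y \<in> VF" if "X \<in> VF" "Y \<in> VF" for X Y
      using that by (simp add: D'_eq)
    then show ?thesis
      by (intro PiE_I) (simp_all add: dual_conn_def)
  qed
  have add: "D' (X + Y) Z = D' X Z + D' Y Z" "D' X (Y + Z) = D' X Y + D' X Z"
    if "X \<in> VF" "Y \<in> VF" "Z \<in> VF" for X Y Z
    using that by (simp_all add: D'_eq dualD_def distribs D_add_left D_add_right algebra_simps)
  have scale: "D' (vf_scale f X) Y = vf_scale f (D' X Y)"
    "D' X (vf_scale f Y) = vf_scale (vf_apply X f) Y + vf_scale f (D' X Y)"
    if f: "f \<in> smooth_funs M" and [simp]: "X \<in> VF" "Y \<in> VF" for f X Y
  proof -
    have [simp]: "vf_scale g Z \<in> VF" if "g \<in> smooth_funs M" "Z \<in> VF" for g Z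
      using vector_fields_scale[OF smooth] that by blast
    have [simp]: "vf_apply X f \<in> smooth_funs M"
      using f \<open>X \<in> VF\<close> by (simp add: vector_fields_def)
    note D_scale = conn[unfolded connection_def, THEN conjunct2, THEN conjunct2, rule_format, OF f]
    note simps = D'_eq dualD_def distribs vf_mult_scale[OF tm] vf_mult_scale_right[OF tm]
      vf_scale_add vf_scale_diff D_scale f
    show "D' (vf_scale f X) Y = vf_scale f (D' X Y)"
      by (simp add: simps)
    show "D' X (vf_scale f Y) = vf_scale (vf_apply X f) Y + vf_scale f (D' X Y)"
      by (simp add: simps)
  qed
  show ?thesis
    unfolding connection_def by (intro conjI ballI D'_pi add scale)
qed

lemma torsion_free_dual: "torsion_free M D'"
  by (simp add: torsion_free_def D'_eq dualD_torsion lie_bracket_eq)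

lemma compatible_dual: "compatible M dm D'"
proof -
  have "cov_mult dm D' X Y Z = dualC X Y Z" if "X \<in> VF" "Y \<in> VF" "Z \<in> VF" for X Y Z
    using that by (simp add: cov_mult_def dualC_def vf_mult_dual_mult D'_eq)
  then show ?thesis
    by (simp add: compatible_def dualC_sym)
qed

lemma special_family_dual: "special_family M dm E (dual_family_of M m e E D)"
proof -
  have "dual_family_of M m e E D = {shifted_conn M dm D' W | W. W \<in> VF}"
    unfolding dual_family_of_def by (subst dual_conn_shifted_conn) (rule refl)
  then show ?thesis
    unfolding special_family_def
    using fm_dual connection_dual torsion_free_dual compatible_dual by blast
qed

text \<open>The correction terms coming from \<open>V\<close> cancel.\<close>

lemma dual_conn_of_shifted_conn:
  assumes "V \<in> VF"
  shows "dual_conn M m e E (shifted_conn M m D V) W = dual_conn M m e E D W"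
proof -
  have "vf_mult m E (shifted_conn M m D V X (vf_mult m F Y))
      - vf_mult m (shifted_conn M m D V (vf_mult m F Y) E) X
    = vf_mult m E (D X (vf_mult m F Y)) - vf_mult m (D (vf_mult m F Y) E) X"
    if "X \<in> VF" "Y \<in> VF" for X Y
    using that assms by (simp add: shifted_conn_def distribs mul_ac)
  then show ?thesis
    by (intro ext) (simp add: dual_conn_def restrict_def)
qed

lemma dual_dual_conn:
  assumes "W \<in> VF"
  shows "dual_conn M dm E e D' W = shifted_conn M m D (shift + W)"
proof -
  have "vf_mult dm e (D' X (vf_mult dm (vf_mult m E E) Y))
      - vf_mult dm (D' (vf_mult dm (vf_mult m E E) Y) e) X + vf_mult m (vf_mult m W X) Y
    = D X Y + vf_mult m (vf_mult m (shift + W) X) Y" if [simp]: "X \<in> VF" "Y \<in> VF" for X Y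
  proof -
    \<comment> \<open>One factor \<open>E\<close> of the inverse of \<open>e\<close> cancels the
      \<open>F\<close> in \<open>dm\<close>, which gives the shape of
      \<open>dualD_dualD\<close>.\<close>
    have "vf_mult dm (vf_mult m E E) Y = vf_mult m E Y"
      by (simp add: vf_mult_dual_mult mul_assoc mul_commute[of Y F])
    then show ?thesis
      using dualD_dualD[of X Y] assms
      by (simp add: D'_eq vf_mult_dual_mult distribs mul_ac algebra_simps)
  qed
  then show ?thesis
    by (intro ext)
      (simp add: dual_conn_def[of M dm] shifted_conn_def restrict_def inverse_dual dual_mult_dual)
qed

text \<open>Translation by \<open>shift\<close> permutes the vector fields, so the displaced family
  is the original one.\<close>

lemma dual_dual_family:
  "dual_family_of M dm E e D' = {shifted_conn M m D V | V. V \<in> VF}"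
proof -
  have "\<exists>W\<in>VF. V = shift + W" if "V \<in> VF" for V
    using that by (intro bexI[of _ "V - shift"]) simp_all
  moreover have "shift + W \<in> VF" if "W \<in> VF" for W
    using that by simp
  ultimately show ?thesis
    unfolding dual_family_of_def using dual_dual_conn by (auto; metis)
qed

end

section \<open>Special families and independence of the chosen connection\<close>

context
  fixes M :: "('a, 'e::euclidean_space) manifold" and m :: "'a tmult" and e E :: "'a vfield"
    and S :: "'a conn set"
  assumes ev: "eventual_identity M m e E" and special: "special_family M m e S"
begin

text \<open>All members of \<open>S\<close> are shifts of one connection and shifts do not affect
  the dual family, so the choice made by \<open>SOME\<close> is immaterial.\<close>

lemma dual_family_eq:
  assumes "D \<in> S"
  shows "dual_family_of M m e E D = dual_family M m e E S"
proof -
  obtain D0 where D0: "connection M D0" "torsion_free M D0" "compatible M m D0"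
    and S: "S = {shifted_conn M m D0 V | V. V \<in> vector_fields M}"
    using special by (auto simp: special_family_def)
  interpret eventual_special M m e E D0
    using ev D0 by unfold_locales
  have "dual_family_of M m e E D = dual_family_of M m e E D0" if "D \<in> S" for D
    using that by (auto simp: S dual_family_of_def dual_conn_of_shifted_conn)
  moreover have "(SOME D. D \<in> S) \<in> S"
    using assms by (rule someI[of "\<lambda>D. D \<in> S"])
  ultimately show ?thesis
    using assms by (simp add: dual_family_def)
qed

text \<open>The base connection itself belongs to \<open>S\<close>, as the shift by
  \<open>V = 0\<close>.\<close>

lemma special_familyE:
  obtains D where "eventual_special M m e E D" "D \<in> S"
    "S = {shifted_conn M m D V | V. V \<in> vector_fields M}"
proof -
  obtain D where D: "connection M D" "torsion_free M D" "compatible M m D"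
    and S: "S = {shifted_conn M m D V | V. V \<in> vector_fields M}"
    using special by (auto simp: special_family_def)
  interpret eventual_special M m e E D
    using ev D by unfold_locales
  have "D \<in> VF \<rightarrow>\<^sub>E VF \<rightarrow>\<^sub>E VF"
    using D(1) by (simp add: connection_def)
  moreover have "D X \<in> VF \<rightarrow>\<^sub>E VF" if "X \<in> VF" for X
    using calculation that by (rule PiE_mem)
  \<comment> \<open>When an argument is not a vector field, extensionality makes both sides the same
    default value.\<close>
  ultimately have "shifted_conn M m D 0 X Y = D X Y" for X Y
    by (cases "X \<in> VF"; cases "Y \<in> VF")
      (simp_all add: shifted_conn_def zero_mul PiE_arb[of D VF "\<lambda>_. VF \<rightarrow>\<^sub>E VF"]
        PiE_arb[of "D X" VF "\<lambda>_. VF"])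
  then have "shifted_conn M m D 0 = D"
    by blast
  then have "D \<in> S"
    unfolding S by (intro CollectI exI[of _ 0]) simp
  then show ?thesis
    using that S eventual_special_axioms by blast
qed

lemma special_family_dual_family:
  "special_family M (dual_mult M m e E) E (dual_family M m e E S)"
  using special_familyE eventual_special.special_family_dual dual_family_eq by metis

end

text \<open>Since \<open>D'\<close> lies in the dual family, independence of the choice, applied to
  the dual structure, lets \<open>D'\<close> stand for the chosen connection.\<close>

lemma dual_family_dual_family:
  assumes ev: "eventual_identity M m e E" and special: "special_family M m e S"
  shows "dual_family M (dual_mult M m e E) E e (dual_family M m e E S) = S"
proof -
  obtain D where D: "eventual_special M m e E D" "D \<in> S"
    and S: "S = {shifted_conn M m D V | V. V \<in> vector_fields M}"
    using special_familyE[OF ev special] by blast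
  interpret eventual_special M m e E D by (rule D)
  have "D' \<in> dual_family M m e E S"
    unfolding dual_family_eq[OF ev special D(2), symmetric] dual_family_of_def
    using zero_closed by blast
  then have "dual_family M dm E e (dual_family M m e E S) = dual_family_of M dm E e D'"
    using dual_family_eq[OF dual special_family_dual_family[OF ev special]] by simp
  then show ?thesis
    using dual_dual_family S by simp
qed

theorem theorem18:
  fixes M :: "('a, 'e::euclidean_space) manifold"
    and m :: "'a tmult"
    and e E :: "'a vfield"
    and S :: "'a conn set"
  assumes "F_manifold M m e"
    and "eventual_identity M m e E"
    and "special_family M m e S"
  shows "(\<forall>D\<in>S. special_family M (dual_mult M m e E) E (dual_family_of M m e E D)
              \<and> dual_family_of M m e E D = dual_family M m e E S)
         \<and> involution_on (special_F_structures :: ('a, 'e) F_structure set) duality"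
proof
  show "\<forall>D\<in>S. special_family M (dual_mult M m e E) E (dual_family_of M m e E D)
      \<and> dual_family_of M m e E D = dual_family M m e E S"
    using dual_family_eq[OF assms(2,3)] special_family_dual_family[OF assms(2,3)] by simp
  have "duality x \<in> special_F_structures \<and> duality (duality x) = x"
    if x: "x \<in> special_F_structures" for x :: "('a, 'e) F_structure"
  proof -
    obtain M m e E S where x_eq: "x = (M, m, e, E, S)"
      by (cases x)
    with x have ev: "eventual_identity M m e E" and special: "special_family M m e S"
      by (simp_all add: special_F_structures_def)
    interpret eventual_F_manifold M m e E
      using ev by unfold_locales
    show ?thesis
      using special_family_dual_family[OF ev special] dual_family_dual_family[OF ev special]
      by (simp add: x_eq duality_def special_F_structures_def fm_dual dual dual_mult_dual)
  qed
  then show "involution_on (special_F_structures :: ('a, 'e) F_structure set) duality"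
    by (simp add: involution_on_def)
qed

end
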